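(* For $k \in \mathbb{Z}$ and $n \geq 1$, \begin{equation*} C_{n}^{(k)}(x)=-xC_{n-1}^{(k)}(x+1)+\frac{1}{n} \sum_{l=0}^{n}\binom{n}{l}B_{l}^{(l)}(1)\left\{C_{n-l}^{(k-1)}(x+1)-C_{n-l}^{(k)}(x+1)\right\}. \end{equation*}
   Context: For $k\in\mathbb{Z}$, $Lif_k(t)=\sum_{m=0}^{\infty}\frac{t^m}{m!(m+1)^k}$, and the poly-Cauchy polynomials $C_n^{(k)}(x)$ are defined by $\frac{Lif_k(\log(1+t))}{(1+t)^x}=\sum_{n=0}^\infty C_n^{(k)}(x)\frac{t^n}{n!}$. The Bernoulli polynomials of order $r$ are defined by $\left(\frac{t}{e^t-1}\right)^r e^{xt}=\sum_{n\ge0}B_n^{(r)}(x)\frac{t^n}{n!}$; $B_l^{(l)}(1)$ is the value at $x=1$ of the one of order $l$ and degree $l$. *)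

theory Defs
  imports "HOL-Computational_Algebra.Formal_Power_Series"
begin

definition Lif :: "int \<Rightarrow> 'a::field_char_0 fps" where
  "Lif k = Abs_fps (\<lambda>m. 1 / (fact m * of_nat (m + 1) powi k))"

(* fps_ln 1 is the series log (1 + t) and fps_binomial x is (1 + t)^x.
   Multiplying the n-th coefficient by n! gives the coefficient of t^n / n!. *)
definition poly_cauchy :: "int \<Rightarrow> nat \<Rightarrow> 'a::field_char_0 \<Rightarrow> 'a" where
  "poly_cauchy k n x = fact n * fps_nth ((Lif k oo fps_ln 1) / fps_binomial x) n"

(* The quotient cancels the common factor t: fps_exp 1 - 1 has subdegree 1. *)
definition bernoulli_order :: "nat \<Rightarrow> nat \<Rightarrow> 'a::field_char_0 \<Rightarrow> 'a" where
  "bernoulli_order r n x = fact n * fps_nth ((fps_X / (fps_exp 1 - 1)) ^ r * fps_exp x) n"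

lemma poly_cauchy_gf:
  "(Lif k oo fps_ln 1) / fps_binomial x = Abs_fps (\<lambda>n. poly_cauchy k n x / fact n)"
  by (simp add: fps_eq_iff poly_cauchy_def)

lemma bernoulli_order_gf:
  "(fps_X / (fps_exp 1 - 1)) ^ r * fps_exp x = Abs_fps (\<lambda>n. bernoulli_order r n x / fact n)"
  by (simp add: fps_eq_iff bernoulli_order_def)

end

theory Submission imports Defs begin

text \<open>
  Write \<open>L = log (1 + t)\<close> and \<open>F\<^sub>k\<^sub>,\<^sub>x = Lif\<^sub>k(L) (1 + t)\<^bsup>-x\<^esup>\<close>. Since \<open>t Lif\<^sub>k' = Lif\<^bsub>k-1\<^esub> - Lif\<^sub>k\<close>,
  differentiating \<open>F\<^sub>k\<^sub>,\<^sub>x\<close> gives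
  \<open>t F\<^sub>k\<^sub>,\<^sub>x' = - x t F\<^sub>k\<^sub>,\<^sub>x\<^sub>+\<^sub>1 + (t / L) (F\<^sub>k\<^sub>-\<^sub>1\<^sub>,\<^sub>x\<^sub>+\<^sub>1 - F\<^sub>k\<^sub>,\<^sub>x\<^sub>+\<^sub>1)\<close>.
  The coefficients of \<open>t / L\<close> are \<open>B\<^sub>l\<^sup>(\<^sup>l\<^sup>)(1) / l!\<close>: both sides are the residue of
  \<open>du / (u\<^sup>l log (1 + u))\<close>, on the Bernoulli side after the substitution \<open>u = e\<^sup>t - 1\<close>.
\<close>

unbundle fps_syntax

text \<open>This is the residue of \<open>h' / h^(m+1)\<close>, the derivative of
  \<open>- 1 / (m h^m)\<close>, and a derivative has no residue.\<close>

lemma fps_deriv_mult_power_nth_eq_0: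
  fixes h \<phi> :: "'a::field_char_0 fps"
  assumes "h * \<phi> = fps_X" and "m > 0"
  shows "(fps_deriv h * \<phi> ^ Suc m) $ m = 0"
proof -
  obtain p where m: "m = Suc p"
    using \<open>m > 0\<close> gr0_implies_Suc by blast
  have "fps_deriv h * \<phi> + h * fps_deriv \<phi> = fps_deriv (h * \<phi>)"
    by (simp add: algebra_simps)
  then have d: "fps_deriv h * \<phi> = 1 - h * fps_deriv \<phi>"
    unfolding assms(1) by (simp add: algebra_simps)
  have "fps_deriv h * \<phi> ^ Suc m = \<phi> ^ m - (h * \<phi>) * (fps_deriv \<phi> * \<phi> ^ p)"
    by (simp add: mult.assoc[symmetric] d) (simp add: m algebra_simps)
  then have "(fps_deriv h * \<phi> ^ Suc m) $ m = (\<phi> ^ m) $ m - (fps_deriv \<phi> * \<phi> ^ p) $ p"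
    unfolding assms(1) by (simp only: fps_sub_nth fps_X_mult_nth) (simp add: m)
  \<comment> \<open>The factor \<open>m\<close> turns \<open>\<phi>' \<phi>^p\<close> into the
    derivative of \<open>\<phi>^m\<close>; characteristic 0 lets it be cancelled at the end.\<close>
  then have "of_nat m * (fps_deriv h * \<phi> ^ Suc m) $ m
      = of_nat m * (\<phi> ^ m) $ m - (of_nat m * (fps_deriv \<phi> * \<phi> ^ p)) $ p"
    by (simp add: right_diff_distrib flip: fps_of_nat)
  also have "of_nat m * (fps_deriv \<phi> * \<phi> ^ p) = fps_deriv (\<phi> ^ m)"
    by (simp only: m fps_deriv_power' diff_Suc_1 mult.assoc)
  also have "of_nat m * (\<phi> ^ m) $ m - fps_deriv (\<phi> ^ m) $ p = 0"
    by (simp add: m del: power_Suc of_nat_Suc)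
  finally show ?thesis
    using \<open>m > 0\<close> by simp
qed

text \<open>
  With \<open>\<phi> = t / h\<close> this says that the residue of \<open>a(h) h' / h\<^bsup>n+1\<^esup>\<close> in \<open>t\<close> equals that of
  \<open>a(u) / u\<^bsup>n+1\<^esup>\<close> in \<open>u\<close>.
\<close>

lemma fps_compose_residue:
  fixes a h \<phi> :: "'a::field_char_0 fps"
  assumes "h * \<phi> = fps_X" and h0: "h $ 0 = 0"
  shows "((a oo h) * (fps_deriv h * \<phi> ^ Suc n)) $ n = a $ n"
proof -
  define P where "P = fps_deriv h * \<phi> ^ Suc n"
  have "((a oo h) * P) $ n = (\<Sum>i=0..n. \<Sum>j=0..i. a $ j * (h ^ j) $ i * P $ (n - i))"
    by (simp add: fps_mult_nth fps_compose_nth sum_distrib_right)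
  \<comment> \<open>The added terms vanish: \<open>h^j\<close> has no coefficients below degree
    \<open>j\<close>.\<close>
  also have "\<dots> = (\<Sum>i=0..n. \<Sum>j=0..n. a $ j * (h ^ j) $ i * P $ (n - i))"
    by (intro sum.cong sum.mono_neutral_left refl)
       (auto simp: startsby_zero_power_prefix[OF h0])
  also have "\<dots> = (\<Sum>j=0..n. \<Sum>i=0..n. a $ j * (h ^ j) $ i * P $ (n - i))"
    by (rule sum.swap)
  also have "\<dots> = (\<Sum>j=0..n. a $ j * (h ^ j * P) $ n)"
    by (simp add: fps_mult_nth sum_distrib_left mult.assoc)
  also have "\<dots> = (\<Sum>j=0..n. if j = n then a $ j else 0)"
  proof (rule sum.cong)
    fix j assume "j \<in> {0..n}"
    then have j: "j \<le> n" by simp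
    \<comment> \<open>Since \<open>(h * \<phi>)^j = t^j\<close> is a mere shift, only a residue with
      \<open>m = n - j\<close> remains: 1 for \<open>m = 0\<close>, otherwise 0.\<close>
    have "h ^ j * P = (h * \<phi>) ^ j * (fps_deriv h * \<phi> ^ Suc (n - j))"
      using j by (simp add: P_def power_mult_distrib algebra_simps flip: power_add)
    then have *: "(h ^ j * P) $ n = (fps_deriv h * \<phi> ^ Suc (n - j)) $ (n - j)"
      using j by (simp add: assms(1) fps_X_power_mult_nth)
    show "a $ j * (h ^ j * P) $ n = (if j = n then a $ j else 0)"
    proof (cases "j = n")
      case True
      have "h $ 1 * \<phi> $ 0 = (h * \<phi>) $ 1"
        by (simp add: fps_mult_nth h0)
      then show ?thesis
        using * True assms(1) by simp
    next
      case False
      then show ?thesis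
        using * j fps_deriv_mult_power_nth_eq_0[OF assms(1), of "n - j"] by simp
    qed
  qed simp
  also have "\<dots> = a $ n"
    by simp
  finally show ?thesis
    by (simp add: P_def)
qed

text \<open>Such an \<open>f\<close> is \<open>t\<close> times a unit, so the division is exact.
  This serves both \<open>e^t - 1\<close> and \<open>log (1 + t)\<close>.\<close>

lemma fps_mult_X_divide_cancel:
  fixes f :: "'a::field fps"
  assumes "f $ 0 = 0" and "f $ 1 \<noteq> 0"
  shows "f * (fps_X / f) = fps_X"
proof -
  have "f \<noteq> 0" using assms(2) by auto
  moreover have "subdegree f = 1"
    using assms by (intro subdegreeI) auto
  ultimately have "f dvd fps_X"
    by (simp add: fps_dvd_iff)
  then show ?thesis by simp
qed

lemma fps_X_divide_ln_nth:
  "(fps_X / fps_ln 1 :: 'a::field_char_0 fps) $ l = bernoulli_order l l 1 / fact l"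
proof -
  define h :: "'a fps" where "h = fps_exp 1 - 1"
  define \<phi> where "\<phi> = fps_X / h"
  define A :: "'a fps" where "A = fps_X / fps_ln 1"
  have h0: "h $ 0 = 0" and h1: "h $ 1 \<noteq> 0"
    by (simp_all add: h_def)
  have h\<phi>: "h * \<phi> = fps_X"
    unfolding \<phi>_def by (rule fps_mult_X_divide_cancel[OF h0 h1])
  have "fps_ln 1 * A = fps_X"
    unfolding A_def by (rule fps_mult_X_divide_cancel) (simp_all add: fps_ln_nth)
  then have "(fps_ln 1 oo h) * (A oo h) = fps_X oo h"
    by (simp add: fps_compose_mult_distrib[OF h0, symmetric])
  moreover have "fps_ln 1 oo h = fps_X"
    using fps_inv[OF h0 h1] by (simp add: h_def fps_ln_fps_exp_inv)
  ultimately have "h * \<phi> * (A oo h) = h"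
    by (simp add: h\<phi> h0)
  moreover have "h \<noteq> 0" using h1 by auto
  ultimately have A\<phi>: "(A oo h) * \<phi> = 1"
    by (metis mult.assoc mult.commute mult_cancel_left mult.right_neutral)
  have "A $ l = ((A oo h) * (fps_deriv h * \<phi> ^ Suc l)) $ l"
    by (rule fps_compose_residue[OF h\<phi> h0, symmetric])
  \<comment> \<open>One factor \<open>\<phi>\<close> cancels against \<open>A oo h\<close>, which
    leaves order \<open>l\<close>; the factor \<open>h' = e^t\<close> accounts for the argument
    1.\<close>
  also have "(A oo h) * (fps_deriv h * \<phi> ^ Suc l) = ((A oo h) * \<phi>) * (\<phi> ^ l * fps_deriv h)"
    by (simp add: ac_simps)
  also have "\<dots> = \<phi> ^ l * fps_exp 1"
    by (simp only: A\<phi>) (simp add: h_def)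
  finally show ?thesis
    by (simp add: A_def \<phi>_def h_def bernoulli_order_def)
qed

text \<open>Coefficientwise, write \<open>n = (n + 1) - 1\<close>; the factor \<open>n + 1\<close>
  lowers \<open>k\<close> by one.\<close>

lemma fps_X_mult_deriv_Lif: "fps_X * fps_deriv (Lif k) = Lif (k - 1) - Lif k"
proof (rule fps_ext)
  fix n
  have "(of_nat (n + 1) :: 'a) powi (k - 1) = of_nat (n + 1) powi k / of_nat (n + 1)"
    by (simp add: power_int_diff del: of_nat_add of_nat_Suc)
  then have "(Lif (k - 1) - Lif k :: 'a fps) $ n = of_nat n / (fact n * of_nat (n + 1) powi k)"
    by (simp add: Lif_def diff_divide_distrib[symmetric])
  also have "\<dots> = (fps_X * fps_deriv (Lif k)) $ n"
    by (cases n) (simp_all add: Lif_def)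
  finally show "(fps_X * fps_deriv (Lif k)) $ n = (Lif (k - 1) - Lif k :: 'a fps) $ n" ..
qed

lemma fps_divide_binomial:
  fixes f :: "'a::field_char_0 fps"
  shows "f / fps_binomial x = f * fps_binomial (- x)"
proof -
  have "fps_binomial x * fps_binomial (- x) = 1"
    using fps_binomial_add_mult[of x "- x"] fps_binomial_of_nat[of 0, where 'a = 'a] by simp
  then have "inverse (fps_binomial x) = fps_binomial (- x)"
    by (rule fps_inverse_unique)
  then show ?thesis
    by (simp add: fps_divide_unit)
qed

lemma poly_cauchy_binomial_gf:
  "(Lif k oo fps_ln 1) * fps_binomial (- x) = Abs_fps (\<lambda>n. poly_cauchy k n x / fact n)"
  by (simp add: poly_cauchy_gf flip: fps_divide_binomial)

lemma poly_cauchy_gf_ODE: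
  fixes x :: "'a::field_char_0"
  defines "F \<equiv> (\<lambda>k x. (Lif k oo fps_ln 1) * fps_binomial (- x) :: 'a fps)"
  shows "fps_X * fps_deriv (F k x)
    = fps_X * (fps_const (- x) * F k (x + 1))
      + (fps_X / fps_ln 1) * (F (k - 1) (x + 1) - F k (x + 1))"
proof -
  define L :: "'a fps" where "L = fps_ln 1"
  define D where "D = fps_deriv (Lif k) oo L"
  define b where "b = fps_binomial (- (x + 1))"
  have L0: "L $ 0 = 0" by (simp add: L_def)
  have LX: "L * (fps_X / L) = fps_X"
    by (rule fps_mult_X_divide_cancel) (simp_all add: L_def fps_ln_nth)
  \<comment> \<open>Both summands of the product rule carry a factor \<open>1 / (1 + t)\<close>,
    which moves \<open>x\<close> to \<open>x + 1\<close>.\<close>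
  have b: "b = inverse (1 + fps_X) * fps_binomial (- x)"
    using fps_binomial_add_mult[of "- x" "- 1"]
    by (simp add: b_def fps_binomial_minus_one mult.commute)
  have dL: "fps_deriv L = inverse (1 + fps_X)"
    by (simp add: L_def fps_ln_deriv)
  have db: "fps_deriv (fps_binomial (- x)) = fps_const (- x) * b"
    by (simp add: fps_binomial_deriv b fps_divide_unit ac_simps)
  have "L * D = (fps_X * fps_deriv (Lif k)) oo L"
    by (simp add: D_def fps_compose_mult_distrib[OF L0] L0)
  then have LD: "L * D = (Lif (k - 1) oo L) - (Lif k oo L)"
    by (simp add: fps_X_mult_deriv_Lif fps_compose_sub_distrib)
  have "fps_deriv (F k x) = fps_const (- x) * F k (x + 1) + D * b"
    by (simp add: F_def fps_compose_deriv[OF L0] db dL b D_def b_def flip: L_def)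
       (simp add: algebra_simps b[unfolded b_def, simplified])
  then have "fps_X * fps_deriv (F k x)
      = fps_X * (fps_const (- x) * F k (x + 1)) + fps_X * (D * b)"
    by (simp only: distrib_left)
  \<comment> \<open>Writing \<open>t = (t / L) L\<close> supplies the factor \<open>L\<close> with
    which \<open>D\<close> becomes \<open>t Lif'\<close> composed with \<open>L\<close>.\<close>
  also have "fps_X * (D * b) = (fps_X / L) * (L * D * b)"
    by (metis LX mult.assoc mult.commute)
  also have "L * D * b = F (k - 1) (x + 1) - F k (x + 1)"
    by (simp only: LD[unfolded L_def] F_def b_def L_def left_diff_distrib)
  finally show ?thesis
    by (simp only: L_def)
qed

theorem theorem4:
  fixes k :: int and n :: nat and x :: "'a::field_char_0"
  assumes "n \<ge> 1"
  shows "poly_cauchy k n x =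
    - x * poly_cauchy k (n - 1) (x + 1) +
    1 / of_nat n * (\<Sum>l=0..n. of_nat (n choose l) * bernoulli_order l l 1 *
      (poly_cauchy (k - 1) (n - l) (x + 1) - poly_cauchy k (n - l) (x + 1)))"
proof -
  define c where "c l = bernoulli_order l l 1 / fact l *
    ((poly_cauchy (k - 1) (n - l) (x + 1) - poly_cauchy k (n - l) (x + 1)) / fact (n - l))" for l
  obtain p where n: "n = Suc p"
    using assms by (cases n) auto
  \<comment> \<open>Compare coefficients of \<open>t^n\<close> in the differential equation;
    \<open>c l\<close> are the terms of the Cauchy product with \<open>t / L\<close>.\<close>
  have "of_nat n * (poly_cauchy k n x / fact n)
      = - x * (poly_cauchy k (n - 1) (x + 1) / fact (n - 1)) + (\<Sum>l=0..n. c l)"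
    using arg_cong[OF poly_cauchy_gf_ODE[of k x], of "\<lambda>f. f $ n"]
    by (simp add: poly_cauchy_binomial_gf fps_mult_nth[of "fps_X / fps_ln 1"] fps_X_divide_ln_nth
          c_def n diff_divide_distrib del: of_nat_Suc fact_Suc minus_add_distrib)
  then have "poly_cauchy k n x
      = - x * poly_cauchy k (n - 1) (x + 1) + fact (n - 1) * (\<Sum>l=0..n. c l)"
    by (simp add: n field_simps del: of_nat_Suc)
  also have "fact (n - 1) * (\<Sum>l=0..n. c l) = 1 / of_nat n * (\<Sum>l=0..n. fact n * c l)"
    by (simp add: n del: of_nat_Suc sum.atLeast0_atMost_Suc flip: sum_distrib_left)
  also have "(\<Sum>l=0..n. fact n * c l) = (\<Sum>l=0..n. of_nat (n choose l) * bernoulli_order l l 1 *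
      (poly_cauchy (k - 1) (n - l) (x + 1) - poly_cauchy k (n - l) (x + 1)))"
    by (intro sum.cong refl) (simp add: c_def binomial_fact)
  finally show ?thesis .
qed

end
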